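(* Let $(\Omega,\Xi)$ be a measurable space and let $G$ be a $\sigma$-finite kernel on $\Omega$ satisfying the weak maximum principle with constant $\mathfrak{b}\ge1$. Let $g:[1,+\infty)\to[1,+\infty)$ be a continuous monotone non-decreasing function, and set $$F(t)=\int_1^t\frac{ds}{g(s)},\qquad t\ge1 .$$ If a measurable function $u:\Omega\to[1,+\infty]$ satisfies $$u(x)\ge G(g(u))(x)+1\quad\text{for all }x\in\Omega,$$ then, for all $x\in\Omega$ such that $u(x)<+\infty$, the following inequalities hold: $$u(x)\ \ge\ 1+\mathfrak{b}\left[F^{-1}\big(\mathfrak{b}^{-1}G1(x)\big)-1\right]$$ and $$\mathfrak{b}^{-1}G1(x)\ <\ a:=\int_1^{+\infty}\frac{ds}{g(s)} .$$
   Context: A $\sigma$-finite kernel $G(x,dy)$ on $(\Omega,\Xi)$: for each $x\in\Omega$, $G(x,dy)$ is a $\sigma$-finite measure on $(\Omega,\Xi)$, and for every $\Xi$-measurable $f:\Omega\to[0,\infty]$ the function $Gf(x)=\int_\Omega f(y)\,G(x,dy)$ is $\Xi$-measurable. $G1$ is $Gf$ with $f\equiv1$. Weak maximum principle with constant $\mathfrak{b}\ge1$: for any non-negative bounded measurable function $f$ on $\Omega$, if $Gf\le1$ in $\{f>0\}$, then $Gf\le\mathfrak{b}$ in $\Omega$. Convention: $g(+\infty)=\lim_{t\to+\infty}g(t)$. The inverse function $F^{-1}$ is defined on $[0,a)$ with values in $[1,+\infty)$. *)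

theory Defs
  imports "HOL-Analysis.Analysis"
begin

text \<open>The measurable space \<open>(\<Omega>, \<Xi>)\<close> is a measure \<open>M\<close> of which only \<open>space M\<close> and \<open>sets M\<close> are used.
  Functions and kernels on \<open>\<Omega>\<close> are total functions on the type, constrained on \<open>space M\<close> only.\<close>

definition kernel_op :: "('a \<Rightarrow> 'a measure) \<Rightarrow> ('a \<Rightarrow> ennreal) \<Rightarrow> 'a \<Rightarrow> ennreal" where
  "kernel_op G f x = (\<integral>\<^sup>+ y. f y \<partial>G x)"

definition sigma_finite_kernel :: "'a measure \<Rightarrow> ('a \<Rightarrow> 'a measure) \<Rightarrow> bool" where
  "sigma_finite_kernel M G \<longleftrightarrow>
     (\<forall>x\<in>space M. sets (G x) = sets M \<and> sigma_finite_measure (G x)) \<and>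
     (\<forall>f\<in>borel_measurable M. kernel_op G f \<in> borel_measurable M)"

definition weak_maximum_principle :: "'a measure \<Rightarrow> ('a \<Rightarrow> 'a measure) \<Rightarrow> real \<Rightarrow> bool" where
  "weak_maximum_principle M G b \<longleftrightarrow>
     (\<forall>f::'a \<Rightarrow> real.
        f \<in> borel_measurable M \<longrightarrow> (\<forall>x\<in>space M. 0 \<le> f x) \<longrightarrow> bounded (f ` space M) \<longrightarrow>
        (\<forall>x\<in>space M. 0 < f x \<longrightarrow> kernel_op G (\<lambda>y. ennreal (f y)) x \<le> 1) \<longrightarrow>
        (\<forall>x\<in>space M. kernel_op G (\<lambda>y. ennreal (f y)) x \<le> ennreal b))"

text \<open>Extension of \<open>g : [1,\<infinity>) \<rightarrow> [1,\<infinity>)\<close> to \<open>[1,\<infinity>]\<close> by \<open>g(\<infinity>) = lim g(t)\<close> as \<open>t \<rightarrow> \<infinity>\<close>. The limit is taken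
  in \<open>[0,\<infinity>]\<close>, where it exists because \<open>g\<close> is monotone.\<close>

definition extend_infinity :: "(real \<Rightarrow> real) \<Rightarrow> ennreal \<Rightarrow> ennreal" where
  "extend_infinity g t =
     (if t = \<infinity> then Lim at_top (\<lambda>s. ennreal (g s)) else ennreal (g (enn2real t)))"

definition recip_integral :: "(real \<Rightarrow> real) \<Rightarrow> real \<Rightarrow> real" where
  "recip_integral g t = (LBINT s:{1..t}. 1 / g s)"

text \<open>The value may be \<open>\<infinity>\<close>, hence the nonnegative integral.\<close>

definition recip_integral_total :: "(real \<Rightarrow> real) \<Rightarrow> ennreal" where
  "recip_integral_total g = (\<integral>\<^sup>+ s\<in>{1..}. ennreal (1 / g s) \<partial>lborel)"

text \<open>Inverse of \<open>F = recip_integral g : [1,\<infinity>) \<rightarrow> [0,a)\<close>, where \<open>a = recip_integral_total g\<close>;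
  outside \<open>[0,a)\<close> the value is unspecified.\<close>

definition recip_integral_inv :: "(real \<Rightarrow> real) \<Rightarrow> real \<Rightarrow> real" where
  "recip_integral_inv g = the_inv_into {1..} (recip_integral g)"

end

theory Submission
  imports Defs
begin

text \<open>Put \<open>f = g(u)\<close> and \<open>v = Gf\<close>, so that \<open>f \<ge> g(1 + v)\<close>. The maximum principle, applied to the part of
  \<open>f\<close> on \<open>{v \<le> t}\<close>, gives \<open>G(f 1_{v \<le> t}) \<le> b t\<close> everywhere. Writing \<open>1 = f \<sqdot> (1/f)\<close> as a layer-cake
  integral and bounding each layer by this estimate and by \<open>v(x)\<close> yields
  \<open>G1(x) \<le> b F(1 + v(x)/b)\<close>. The theorem follows by inverting \<open>F\<close>, since \<open>u(x) \<ge> 1 + v(x)\<close>.\<close>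

section \<open>The maximum principle on sublevel sets of the potential\<close>

lemma SUP_min_of_nat_ennreal: "(SUP n. min (a::ennreal) (of_nat n)) = a"
  by (simp flip: inf_min inf_SUP add: ennreal_SUP_of_nat_eq_top)

text \<open>The maximum principle speaks only of bounded real functions, whereas \<open>f\<close>
  may be unbounded or infinite. So \<open>f\<close> is cut off at \<open>n\<close>, restricted to
  the sublevel set and divided by \<open>t\<close>. Where the result is positive its potential is at
  most \<open>t / t = 1\<close>, hence it is at most \<open>b\<close> everywhere. Rescaling by
  \<open>t\<close> and letting \<open>n\<close> grow gives the bound by monotone
  convergence.\<close>

lemma weak_maximum_principle_sublevel:
  fixes f :: "'a \<Rightarrow> ennreal" and t :: real
  assumes ker: "sigma_finite_kernel M G"
    and wmp: "weak_maximum_principle M G b"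
    and f[measurable]: "f \<in> borel_measurable M"
    and t: "0 < t" and b: "0 \<le> b" and x: "x \<in> space M"
  shows "kernel_op G (\<lambda>y. f y * indicator {y. kernel_op G f y \<le> ennreal t} y) x \<le> ennreal (b * t)"
proof -
  let ?A = "{y. kernel_op G f y \<le> ennreal t}"
  have sets: "sets (G y) = sets M" if "y \<in> space M" for y
    using ker that by (auto simp: sigma_finite_kernel_def)
  have v[measurable]: "kernel_op G f \<in> borel_measurable M"
    using ker f by (auto simp: sigma_finite_kernel_def)
  define h where "h n y = min (f y) (of_nat n) * indicator ?A y" for n :: nat and y
  have h_meas[measurable]: "h n \<in> borel_measurable M" for n
    unfolding h_def by measurable
  have h_le: "h n y \<le> of_nat n" for n y
    by (auto simp: h_def indicator_def)
  have h_fin: "h n y < top" for n y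
    using h_le[of n y] by (simp add: order_le_less_trans of_nat_less_top)
  have G_h: "kernel_op G (h n) x \<le> ennreal (b * t)" if "x \<in> space M" for n x
  proof -
    \<comment> \<open>The truncation \<open>h n\<close> is finite, so \<open>enn2real\<close> loses
      nothing here.\<close>
    define k where "k y = enn2real (h n y) / t" for y
    have k: "ennreal (k y) = h n y * ennreal (1/t)" for y
    proof -
      have "k y = enn2real (h n y) * (1/t)"
        by (simp add: k_def)
      then have "ennreal (k y) = ennreal (enn2real (h n y)) * ennreal (1/t)"
        using t by (simp add: ennreal_mult[symmetric])
      then show ?thesis
        using h_fin[of n y] by simp
    qed
    have G_k: "kernel_op G (\<lambda>y. ennreal (k y)) z = kernel_op G (h n) z * ennreal (1/t)"
      if "z \<in> space M" for z
      unfolding kernel_op_def k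
      by (rule nn_integral_multc) (simp add: measurable_cong_sets[OF sets[OF that] refl])
    have "k \<in> borel_measurable M"
      unfolding k_def by measurable
    moreover have "\<forall>y\<in>space M. 0 \<le> k y"
      using t by (simp add: k_def)
    moreover have "bounded (k ` space M)"
    proof (rule boundedI)
      fix r assume "r \<in> k ` space M"
      then obtain y where r: "r = k y" by auto
      have "enn2real (h n y) \<le> real n"
        using h_le[of n y] by (simp add: enn2real_leI ennreal_of_nat_eq_real_of_nat)
      then show "norm r \<le> real n / t"
        using t by (simp add: r k_def divide_right_mono)
    qed
    moreover have "\<forall>y\<in>space M. 0 < k y \<longrightarrow> kernel_op G (\<lambda>y. ennreal (k y)) y \<le> 1"
    proof (intro ballI impI)
      fix y assume y: "y \<in> space M" and "0 < k y"
      \<comment> \<open>Off \<open>?A\<close> the indicator makes \<open>k\<close> vanish, so the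
        premise of the maximum principle is only to be checked where \<open>kernel_op G f\<close> is
        at most \<open>t\<close>.\<close>
      then have "y \<in> ?A"
        by (cases "y \<in> ?A") (auto simp: k_def h_def)
      have "kernel_op G (h n) y \<le> kernel_op G f y"
        unfolding kernel_op_def h_def by (intro nn_integral_mono) (auto simp: indicator_def)
      also have "\<dots> \<le> ennreal t"
        using \<open>y \<in> ?A\<close> by simp
      finally have "kernel_op G (h n) y * ennreal (1/t) \<le> ennreal t * ennreal (1/t)"
        by (rule mult_right_mono) simp
      then show "kernel_op G (\<lambda>y. ennreal (k y)) y \<le> 1"
        using t G_k[OF y] by (simp add: ennreal_mult[symmetric])
    qed
    ultimately have "kernel_op G (\<lambda>y. ennreal (k y)) x \<le> ennreal b"
      using wmp that unfolding weak_maximum_principle_def by blast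
    then have "kernel_op G (h n) x * ennreal (1/t) * ennreal t \<le> ennreal b * ennreal t"
      using G_k[OF that] by (intro mult_right_mono) simp_all
    then show ?thesis
      using t b by (simp add: mult.assoc ennreal_mult[symmetric])
  qed
  have "incseq h"
    unfolding h_def by (intro incseq_SucI le_funI mult_right_mono) (auto simp: min_le_iff_disj min.coboundedI2 simp del: of_nat_Suc)
  have "f y * indicator ?A y = (SUP n. h n y)" for y
    by (cases "y \<in> ?A") (auto simp: h_def SUP_min_of_nat_ennreal)
  then have "kernel_op G (\<lambda>y. f y * indicator ?A y) x = (\<integral>\<^sup>+y. (SUP n. h n y) \<partial>G x)"
    by (simp add: kernel_op_def)
  also have "\<dots> = (SUP n. \<integral>\<^sup>+y. h n y \<partial>G x)"
    by (rule nn_integral_monotone_convergence_SUP[OF \<open>incseq h\<close>])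
      (simp add: measurable_cong_sets[OF sets[OF x] refl])
  also have "\<dots> \<le> ennreal (b * t)"
    using G_h[OF x] by (auto intro!: SUP_least simp: kernel_op_def)
  finally show ?thesis .
qed

section \<open>The layer-cake estimate of \<open>G1\<close>\<close>

text \<open>Hypothesis \<open>g_le\<close> expresses \<open>f \<ge> g(1 + Gf)\<close> through real
  \<open>t\<close> only, so that it also makes sense where \<open>Gf\<close> is infinite. Both
  \<open>1\<close> under \<open>G x\<close> and \<open>1 / g\<close> under Lebesgue measure are
  sliced by the same parameter \<open>l\<close>, and the slices are compared for each
  \<open>l\<close> separately.\<close>

lemma kernel_one_le:
  fixes f :: "'a \<Rightarrow> ennreal" and g :: "real \<Rightarrow> real"
  assumes ker: "sigma_finite_kernel M G"
    and wmp: "weak_maximum_principle M G b"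
    and b: "0 < b"
    and f[measurable]: "f \<in> borel_measurable M"
    and f_ge: "\<And>y. y \<in> space M \<Longrightarrow> 1 \<le> f y"
    and g_cont: "continuous_on {1..} g"
    and g_pos: "\<And>t. 1 \<le> t \<Longrightarrow> 0 < g t"
    and g_le: "\<And>y t. y \<in> space M \<Longrightarrow> 1 \<le> t \<Longrightarrow> ennreal (t - 1) \<le> kernel_op G f y \<Longrightarrow> ennreal (g t) \<le> f y"
    and x: "x \<in> space M" and V: "0 \<le> V" "kernel_op G f x = ennreal V"
  shows "kernel_op G (\<lambda>_. 1) x \<le> ennreal b * (\<integral>\<^sup>+s\<in>{1..1 + V / b}. ennreal (1 / g s) \<partial>lborel)"
proof -
  let ?I = "{1..1 + V / b}"
  let ?N = "G x"
  have sets_N[measurable_cong]: "sets ?N = sets M" and sf: "sigma_finite_measure ?N"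
    using ker x by (auto simp: sigma_finite_kernel_def)
  have space_N: "space ?N = space M"
    using sets_N by (rule sets_eq_imp_space_eq)
  interpret N: pair_sigma_finite lborel ?N
    using sf by (simp add: pair_sigma_finite_def lborel.sigma_finite_measure_axioms)
  \<comment> \<open>Continuing \<open>g\<close> by the constant \<open>g 1\<close> to the left of 1
    gives a function that is Borel on the whole line, as the interchange of integrals requires, and
    that equals \<open>g\<close> on \<open>?I\<close>.\<close>
  define g' where "g' s = g (max 1 s)" for s
  have "continuous_on UNIV g'"
    unfolding g'_def by (intro continuous_on_compose2[OF g_cont] continuous_intros) auto
  then have g'_meas[measurable]: "g' \<in> borel_measurable borel"
    by (rule borel_measurable_continuous_onI)
  have g'_pos: "0 < g' s" for s
    using g_pos by (simp add: g'_def)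
  \<comment> \<open>The identity serves for \<open>c = f y\<close> and again for
    \<open>c = g' s\<close>. The factor \<open>indicator {0<..}\<close> is essential: every negative
    \<open>l\<close> satisfies \<open>l * c < 1\<close>.\<close>
  have layer_ennreal: "(\<integral>\<^sup>+l. indicator {0<..} l * indicator {l. l * c < 1} l \<partial>lborel) = ennreal (1 / c)"
    if "0 < c" for c :: real
  proof -
    have "(\<lambda>l. indicator {0<..} l * indicator {l. l * c < 1} l) = (indicator {0<..<1/c} :: real \<Rightarrow> ennreal)"
      using that by (auto simp: indicator_def fun_eq_iff field_simps)
    then show ?thesis
      using that by simp
  qed
  \<comment> \<open>Where \<open>f y\<close> is infinite no \<open>l > 0\<close> satisfies
    \<open>ennreal l * f y < 1\<close>, and the layers would add up to 0 instead of 1. Finiteness of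
    \<open>V\<close> makes this set null for \<open>G x\<close>.\<close>
  have fin: "AE y in ?N. f y \<noteq> \<infinity>"
    using V by (intro nn_integral_PInf_AE) (auto simp: kernel_op_def)
  have layer: "(\<integral>\<^sup>+l. indicator {0<..} l * (f y * indicator {y. ennreal l * f y < 1} y) \<partial>lborel) = 1"
    if y: "y \<in> space M" "f y \<noteq> \<infinity>" for y
  proof -
    obtain c where c: "f y = ennreal c" "1 \<le> c"
      using y(2) f_ge[OF y(1)] by (cases "f y") auto
    have "(\<integral>\<^sup>+l. indicator {0<..} l * (f y * indicator {y. ennreal l * f y < 1} y) \<partial>lborel)
        = (\<integral>\<^sup>+l. ennreal c * (indicator {0<..} l * indicator {l. l * c < 1} l) \<partial>lborel)"
      using c by (intro nn_integral_cong)
        (auto simp: indicator_def ennreal_mult[symmetric] ennreal_less_one_iff)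
    also have "\<dots> = ennreal c * ennreal (1/c)"
      using c by (simp add: nn_integral_cmult layer_ennreal)
    also have "\<dots> = 1"
      using c by (simp add: ennreal_mult[symmetric])
    finally show ?thesis .
  qed
  \<comment> \<open>Let \<open>r\<close> be the left side. Every \<open>s\<close> strictly between
    \<open>1\<close> and \<open>1 + r / b\<close> turns out to lie in the set on the right, whose
    length is therefore at least \<open>r / b\<close>.\<close>
  have slice: "(\<integral>\<^sup>+y. f y * indicator {y. ennreal l * f y < 1} y \<partial>?N)
      \<le> ennreal b * (\<integral>\<^sup>+s. indicator ?I s * indicator {s. l * g' s < 1} s \<partial>lborel)"
    (is "?L \<le> _") if l: "0 < l" for l :: real
  proof -
    have "?L \<le> (\<integral>\<^sup>+y. f y \<partial>?N)"
      by (intro nn_integral_mono) (simp add: indicator_def)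
    then have "?L \<le> ennreal V"
      using V by (simp add: kernel_op_def)
    then obtain r where r: "?L = ennreal r" "0 \<le> r" "r \<le> V"
      using V by (cases ?L) (auto simp: top_unique)
    \<comment> \<open>Suppose \<open>g s \<ge> 1 / l\<close>. Then \<open>f y < 1 / l\<close> forces
      \<open>Gf(y) \<le> s - 1\<close> by \<open>g_le\<close>, so the slice is supported in a
      sublevel set and \<open>r \<le> b * (s - 1)\<close>, contrary to the choice of
      \<open>s\<close>. The strict bound \<open>1 < s\<close> makes the level \<open>s - 1\<close>
      positive.\<close>
    have "l * g' s < 1" if s: "1 < s" "s < 1 + r / b" for s
    proof (rule ccontr)
      assume neg: "\<not> l * g' s < 1"
      have "kernel_op G f y \<le> ennreal (s - 1)" if "y \<in> space M" "ennreal l * f y < 1" for y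
      proof (rule ccontr)
        assume "\<not> ?thesis"
        then have "ennreal (g s) \<le> f y"
          using s that by (intro g_le) auto
        then have "ennreal l * ennreal (g s) < 1"
          using that(2) by (meson mult_left_mono order_le_less_trans zero_le)
        then show False
          using neg l s by (simp add: g'_def ennreal_mult'[symmetric] ennreal_less_one_iff max_def)
      qed
      then have "?L \<le> (\<integral>\<^sup>+y. f y * indicator {y. kernel_op G f y \<le> ennreal (s - 1)} y \<partial>?N)"
        by (intro nn_integral_mono) (auto simp: indicator_def space_N)
      also have "\<dots> \<le> ennreal (b * (s - 1))"
        using weak_maximum_principle_sublevel[OF ker wmp f _ _ x, of "s - 1"] s b
        by (simp add: kernel_op_def)
      finally have "r \<le> b * (s - 1)"
        using s b r by simp
      then show False
        using s b by (simp add: field_simps)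
    qed
    \<comment> \<open>As the slice is at most the whole potential \<open>V\<close>, the interval up
      to \<open>1 + r / b\<close> stays inside \<open>?I\<close>.\<close>
    moreover have "r / b \<le> V / b"
      using r b by (intro divide_right_mono) auto
    ultimately have "indicator {1<..<1 + r / b} s \<le> (indicator ?I s * indicator {s. l * g' s < 1} s :: ennreal)" for s
      by (simp add: indicator_def)
    then have "(\<integral>\<^sup>+s. indicator {1<..<1 + r / b} s \<partial>lborel)
        \<le> (\<integral>\<^sup>+s. indicator ?I s * indicator {s. l * g' s < 1} s \<partial>lborel)"
      by (intro nn_integral_mono)
    then have "ennreal (r / b) \<le> (\<integral>\<^sup>+s. indicator ?I s * indicator {s. l * g' s < 1} s \<partial>lborel)"
      using r b by simp
    then have "ennreal b * ennreal (r / b) \<le> ennreal b * (\<integral>\<^sup>+s. indicator ?I s * indicator {s. l * g' s < 1} s \<partial>lborel)"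
      by (rule mult_left_mono) simp
    then show ?thesis
      using r b by (simp add: ennreal_mult[symmetric])
  qed
  have "kernel_op G (\<lambda>_. 1) x
      = (\<integral>\<^sup>+y. (\<integral>\<^sup>+l. indicator {0<..} l * (f y * indicator {y. ennreal l * f y < 1} y) \<partial>lborel) \<partial>?N)"
    unfolding kernel_op_def
  proof (intro nn_integral_cong_AE)
    show "AE y in ?N. 1 = (\<integral>\<^sup>+l. indicator {0<..} l * (f y * indicator {y. ennreal l * f y < 1} y) \<partial>lborel)"
      using fin AE_space
      by eventually_elim (rule layer[symmetric], simp_all add: space_N)
  qed
  \<comment> \<open>Tonelli in \<open>l\<close> and \<open>y\<close>; this is where sigma-finiteness
    of \<open>G x\<close> enters.\<close>
  also have "\<dots> = (\<integral>\<^sup>+l. (\<integral>\<^sup>+y. indicator {0<..} l * (f y * indicator {y. ennreal l * f y < 1} y) \<partial>?N) \<partial>lborel)"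
    by (rule N.Fubini') measurable
  also have "\<dots> = (\<integral>\<^sup>+l. indicator {0<..} l * (\<integral>\<^sup>+y. f y * indicator {y. ennreal l * f y < 1} y \<partial>?N) \<partial>lborel)"
    by (intro nn_integral_cong nn_integral_cmult) measurable
  also have "\<dots> \<le> (\<integral>\<^sup>+l. indicator {0<..} l *
      (ennreal b * (\<integral>\<^sup>+s. indicator ?I s * indicator {s. l * g' s < 1} s \<partial>lborel)) \<partial>lborel)"
    using slice by (intro nn_integral_mono) (auto simp: indicator_def)
  also have "\<dots> = ennreal b * (\<integral>\<^sup>+l. (\<integral>\<^sup>+s. indicator {0<..} l *
      (indicator ?I s * indicator {s. l * g' s < 1} s) \<partial>lborel) \<partial>lborel)"
    by (simp add: nn_integral_cmult mult.left_commute)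
  \<comment> \<open>Tonelli in \<open>l\<close> and \<open>s\<close> undoes the slicing on the other
    side: for fixed \<open>s\<close> the admissible \<open>l\<close> fill an interval of length
    \<open>1 / g' s\<close>.\<close>
  also have "(\<integral>\<^sup>+l. (\<integral>\<^sup>+s. indicator {0<..} l *
        (indicator ?I s * indicator {s. l * g' s < 1} s) \<partial>lborel) \<partial>lborel)
      = (\<integral>\<^sup>+s. (\<integral>\<^sup>+l. indicator {0<..} l *
        (indicator ?I s * indicator {s. l * g' s < 1} s) \<partial>lborel) \<partial>lborel)"
    by (rule lborel_pair.Fubini') measurable
  also have "\<dots> = (\<integral>\<^sup>+s. indicator ?I s * (\<integral>\<^sup>+l. indicator {0<..} l * indicator {l. l * g' s < 1} l \<partial>lborel) \<partial>lborel)"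
    by (intro nn_integral_cong, subst nn_integral_cmult[symmetric])
      (auto simp: indicator_def intro!: nn_integral_cong)
  also have "\<dots> = (\<integral>\<^sup>+s\<in>?I. ennreal (1 / g s) \<partial>lborel)"
    unfolding layer_ennreal[OF g'_pos] by (intro nn_integral_cong) (auto simp: g'_def indicator_def)
  finally show ?thesis .
qed

section \<open>The extension of \<open>g\<close> to infinity\<close>

text \<open>By monotonicity the limit is the supremum of \<open>g\<close> over \<open>{1..}\<close>,
  possibly infinite.\<close>

lemma Lim_at_top_ennreal_ge:
  fixes g :: "real \<Rightarrow> real"
  assumes g: "mono_on {1..} g" and t: "1 \<le> t"
  shows "ennreal (g t) \<le> Lim at_top (\<lambda>s. ennreal (g s))"
proof -
  let ?S = "SUP s\<in>{1..}. ennreal (g s)"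
  have "((\<lambda>s. ennreal (g s)) \<longlongrightarrow> ?S) at_top"
  proof (rule order_tendstoI)
    fix a assume "a < ?S"
    then obtain s where s: "1 \<le> s" "a < ennreal (g s)"
      by (auto simp: less_SUP_iff)
    show "\<forall>\<^sub>F r in at_top. a < ennreal (g r)"
      using eventually_ge_at_top[of s]
    proof eventually_elim
      case (elim r)
      then have "g s \<le> g r"
        using s by (intro mono_onD[OF g]) auto
      then show ?case
        using s(2) by (meson ennreal_leI less_le_trans)
    qed
  next
    fix a assume a: "?S < a"
    have "ennreal (g r) < a" if "1 \<le> r" for r
      using a by (rule le_less_trans[rotated]) (use that in \<open>auto intro: SUP_upper\<close>)
    then show "\<forall>\<^sub>F r in at_top. ennreal (g r) < a"
      using eventually_ge_at_top[of 1] by (rule eventually_mono[rotated])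
  qed
  then have "Lim at_top (\<lambda>s. ennreal (g s)) = ?S"
    by (intro tendsto_Lim) auto
  then show ?thesis
    using t by (auto intro: SUP_upper)
qed

text \<open>This turns \<open>1 + Gf \<le> u\<close> into \<open>g(1 + Gf) \<le> g(u)\<close>, also
  at points where \<open>u\<close> is infinite.\<close>

lemma extend_infinity_ge:
  assumes g: "mono_on {1..} g" and t: "1 \<le> t" "ennreal t \<le> a"
  shows "ennreal (g t) \<le> extend_infinity g a"
proof (cases "a = \<infinity>")
  case True
  then show ?thesis
    using Lim_at_top_ennreal_ge[OF g t(1)] by (simp add: extend_infinity_def)
next
  case False
  then have "t \<le> enn2real a"
    using t by (cases a) auto
  then have "g t \<le> g (enn2real a)"
    using t by (intro mono_onD[OF g]) auto
  then show ?thesis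
    using False by (simp add: extend_infinity_def ennreal_leI)
qed

lemma borel_measurable_extend_infinity:
  assumes g: "continuous_on {1..} g"
    and u[measurable]: "u \<in> borel_measurable M" and u_ge: "\<And>x. x \<in> space M \<Longrightarrow> 1 \<le> u x"
  shows "(\<lambda>x. extend_infinity g (u x)) \<in> borel_measurable M"
proof -
  have "continuous_on UNIV (\<lambda>s. g (max 1 s))"
    by (intro continuous_on_compose2[OF g] continuous_intros) auto
  then have [measurable]: "(\<lambda>s. g (max 1 s)) \<in> borel_measurable borel"
    by (rule borel_measurable_continuous_onI)
  \<comment> \<open>Since \<open>u \<ge> 1\<close> on the space, inserting \<open>max 1\<close>
    changes no finite value and replaces \<open>g\<close> by a function that is Borel on the whole
    line.\<close>
  have "extend_infinity g (u x) =
      (if u x = \<infinity> then Lim at_top (\<lambda>s. ennreal (g s)) else ennreal (g (max 1 (enn2real (u x)))))"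
    if "x \<in> space M" for x
  proof (cases "u x = \<infinity>")
    case False
    then have "1 \<le> enn2real (u x)"
      using u_ge[OF that] by (cases "u x") auto
    then show ?thesis
      by (simp add: extend_infinity_def max_def)
  qed (simp add: extend_infinity_def)
  then show ?thesis
    by (subst measurable_cong) (assumption, measurable)
qed

section \<open>The function \<open>F\<close> and its inverse\<close>

context
  fixes g :: "real \<Rightarrow> real"
  assumes g_cont: "continuous_on {1..} g"
    and g_ge_1: "\<And>t. 1 \<le> t \<Longrightarrow> 1 \<le> g t"
begin

lemma continuous_on_recip: "continuous_on {1..} (\<lambda>s. 1 / g s)"
  using g_cont g_ge_1 by (intro continuous_on_divide continuous_intros) force+

lemma set_integrable_recip: "set_integrable lborel {1..t} (\<lambda>s. 1 / g s)"
  using continuous_on_recip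
  by (intro borel_integrable_atLeastAtMost') (auto elim: continuous_on_subset)

lemma ennreal_recip_integral:
  "(\<integral>\<^sup>+s\<in>{1..t}. ennreal (1 / g s) \<partial>lborel) = ennreal (recip_integral g t)"
proof -
  have nonneg: "0 \<le> indicator {1..t} s *\<^sub>R (1 / g s)" for s
    using g_ge_1[of s] by (auto simp: indicator_def)
  have "(\<integral>\<^sup>+s\<in>{1..t}. ennreal (1 / g s) \<partial>lborel)
      = (\<integral>\<^sup>+s. ennreal (indicator {1..t} s *\<^sub>R (1 / g s)) \<partial>lborel)"
    by (intro nn_integral_cong) (auto simp: indicator_def)
  also have "\<dots> = ennreal (recip_integral g t)"
    unfolding recip_integral_def set_lebesgue_integral_def
    using set_integrable_recip[of t] nonneg
    by (intro nn_integral_eq_integral) (auto simp: set_integrable_def)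
  finally show ?thesis .
qed

text \<open>Passing to the gauge integral makes the fundamental theorem of calculus
  applicable.\<close>

lemma recip_integral_eq_integral: "recip_integral g t = integral {1..t} (\<lambda>s. 1 / g s)"
  unfolding recip_integral_def by (rule set_borel_integral_eq_integral[OF set_integrable_recip])

text \<open>The derivative is taken within \<open>{1..T}\<close> because at 1 it is only one-sided:
  \<open>recip_integral g\<close> is constantly 0 to the left of 1.\<close>

lemma recip_integral_has_derivative:
  assumes "1 \<le> t" "t \<le> T"
  shows "(recip_integral g has_real_derivative 1 / g t) (at t within {1..T})"
proof -
  have "continuous_on {1..T} (\<lambda>s. 1 / g s)"
    using continuous_on_recip by (rule continuous_on_subset) auto
  then show ?thesis
    using integral_has_real_derivative[of 1 T "\<lambda>s. 1 / g s" t] assms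
    by (simp add: recip_integral_eq_integral[abs_def])
qed

lemma continuous_on_recip_integral: "continuous_on {1..T} (recip_integral g)"
  using recip_integral_has_derivative by (intro DERIV_continuous_on) auto

lemma recip_integral_strict_mono:
  assumes st: "1 \<le> s" "s < t"
  shows "recip_integral g s < recip_integral g t"
proof (rule DERIV_pos_imp_increasing_open[OF st(2)])
  fix r assume r: "s < r" "r < t"
  then have "(recip_integral g has_real_derivative 1 / g r) (at r)"
    using recip_integral_has_derivative[of r t] st by (simp add: at_within_Icc_at)
  moreover have "0 < 1 / g r"
    using g_ge_1[of r] r st by simp
  ultimately show "\<exists>y. (recip_integral g has_real_derivative y) (at r) \<and> 0 < y"
    by blast
next
  show "continuous_on {s..t} (recip_integral g)"
    using continuous_on_recip_integral by (rule continuous_on_subset) (use st in auto)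
qed

lemma recip_integral_one: "recip_integral g 1 = 0"
  by (simp add: recip_integral_eq_integral)

lemma recip_integral_nonneg: "1 \<le> t \<Longrightarrow> 0 \<le> recip_integral g t"
  using recip_integral_strict_mono[of 1 t] recip_integral_one by (cases "t = 1") auto

lemma recip_integral_inv_eq:
  assumes "1 \<le> s"
  shows "recip_integral_inv g (recip_integral g s) = s"
proof -
  have "strict_mono_on {1..} (recip_integral g)"
    using recip_integral_strict_mono by (auto simp: strict_mono_on_def)
  then have "inj_on (recip_integral g) {1..}"
    by (rule strict_mono_on_imp_inj_on)
  then show ?thesis
    using assms by (simp add: recip_integral_inv_def the_inv_into_f_f)
qed

text \<open>The intermediate value theorem on \<open>{1..t}\<close> shows at once that
  \<open>r\<close> is a value of \<open>F\<close>, so that the inverse is meaningful at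
  \<open>r\<close>, and that its preimage is at most \<open>t\<close>.\<close>

lemma recip_integral_inv_le:
  assumes r: "0 \<le> r" "r \<le> recip_integral g t" and t: "1 \<le> t"
  shows "recip_integral_inv g r \<le> t"
proof -
  obtain s where "1 \<le> s" "s \<le> t" "recip_integral g s = r"
    using IVT'[of "recip_integral g" 1 r t] r t recip_integral_one continuous_on_recip_integral by auto
  then show ?thesis
    using recip_integral_inv_eq by auto
qed

text \<open>Strictness comes from the positive contribution of the interval from \<open>t\<close> to
  \<open>t + 1\<close>.\<close>

lemma recip_integral_less_total:
  assumes t: "1 \<le> t"
  shows "ennreal (recip_integral g t) < recip_integral_total g"
proof -
  have "ennreal (recip_integral g t) < ennreal (recip_integral g (t + 1))"
    using recip_integral_strict_mono[of t "t + 1"] recip_integral_nonneg[OF t] t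
    by (intro ennreal_lessI) auto
  also have "\<dots> \<le> recip_integral_total g"
    unfolding recip_integral_total_def ennreal_recip_integral[symmetric]
    by (intro nn_integral_mono) (auto simp: indicator_def)
  finally show ?thesis .
qed

end

section \<open>Inverting \<open>F\<close> at the estimate of \<open>G1\<close>\<close>

theorem theorem3p2:
  fixes M :: "'a measure" and G :: "'a \<Rightarrow> 'a measure" and b :: real
    and g :: "real \<Rightarrow> real" and u :: "'a \<Rightarrow> ennreal"
  assumes "sigma_finite_kernel M G"
    and "1 \<le> b"
    and "weak_maximum_principle M G b"
    and "continuous_on {1..} g"
    and "mono_on {1..} g"
    and "\<And>t. 1 \<le> t \<Longrightarrow> 1 \<le> g t"
    and "u \<in> borel_measurable M"
    and "\<And>x. x \<in> space M \<Longrightarrow> 1 \<le> u x"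
    and "\<And>x. x \<in> space M \<Longrightarrow> kernel_op G (\<lambda>y. extend_infinity g (u y)) x + 1 \<le> u x"
  shows "\<forall>x\<in>space M. u x < \<infinity> \<longrightarrow>
           1 + b * (recip_integral_inv g (enn2real (kernel_op G (\<lambda>_. 1) x / ennreal b)) - 1)
             \<le> enn2real (u x) \<and>
           kernel_op G (\<lambda>_. 1) x / ennreal b < recip_integral_total g"
proof (intro ballI impI)
  fix x assume x: "x \<in> space M" and u_fin: "u x < \<infinity>"
  define f where "f y = extend_infinity g (u y)" for y
  have f_meas: "f \<in> borel_measurable M"
    unfolding f_def by (rule borel_measurable_extend_infinity[OF assms(4,7,8)])
  have f_ge: "ennreal (g t) \<le> f y" if "1 \<le> t" "ennreal t \<le> u y" for t y
    unfolding f_def using assms(5) that by (rule extend_infinity_ge)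
  have u_ge: "kernel_op G f y + 1 \<le> u y" if "y \<in> space M" for y
    using assms(9)[OF that] by (simp add: f_def[abs_def])
  have f_ge_1: "1 \<le> f y" if "y \<in> space M" for y
    using f_ge[of 1 y] assms(6)[of 1] assms(8)[OF that] by (metis ennreal_1 ennreal_leI order_refl order_trans)
  obtain U where U: "u x = ennreal U" "0 \<le> U"
    using u_fin by (cases "u x") auto
  obtain V where V: "kernel_op G f x = ennreal V" "0 \<le> V"
    using u_ge[OF x] u_fin by (cases "kernel_op G f x") (auto simp: top_unique)
  have "ennreal (V + 1) \<le> ennreal U"
    using u_ge[OF x] U V by simp
  then have VU: "V + 1 \<le> U"
    using U V by (simp del: ennreal_plus)
  \<comment> \<open>This choice satisfies \<open>b * (?T - 1) = V\<close>, and
    \<open>V \<le> U - 1\<close>, which is what the first inequality needs.\<close>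
  let ?T = "1 + V / b"
  have T: "1 \<le> ?T"
    using V assms(2) by simp
  have "kernel_op G (\<lambda>_. 1) x \<le> ennreal b * (\<integral>\<^sup>+s\<in>{1..?T}. ennreal (1 / g s) \<partial>lborel)"
  proof (rule kernel_one_le[OF assms(1,3) _ f_meas f_ge_1 assms(4) _ _ x V(2,1)])
    fix y t assume y: "y \<in> space M" "1 \<le> (t::real)" "ennreal (t - 1) \<le> kernel_op G f y"
    \<comment> \<open>From \<open>t - 1 \<le> Gf(y)\<close> follows
      \<open>t \<le> Gf(y) + 1 \<le> u y\<close>, and monotonicity of the extended \<open>g\<close>
      applies.\<close>
    have "ennreal t = ennreal (t - 1) + 1"
      using y by (simp add: ennreal_1[symmetric] ennreal_plus[symmetric] del: ennreal_1 ennreal_plus)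
    also have "\<dots> \<le> kernel_op G f y + 1"
      using y by (intro add_right_mono)
    also have "\<dots> \<le> u y"
      using y by (intro u_ge)
    finally show "ennreal (g t) \<le> f y"
      using y by (intro f_ge)
  qed (use assms(2,6) in force)+
  also have "(\<integral>\<^sup>+s\<in>{1..?T}. ennreal (1 / g s) \<partial>lborel) = ennreal (recip_integral g ?T)"
    by (rule ennreal_recip_integral[where g = g, OF assms(4,6)])
  finally have "kernel_op G (\<lambda>_. 1) x \<le> ennreal b * ennreal (recip_integral g ?T)" .
  then have "kernel_op G (\<lambda>_. 1) x / ennreal b \<le> ennreal b * ennreal (recip_integral g ?T) / ennreal b"
    by (rule divide_right_mono_ennreal)
  also have "\<dots> = ennreal (recip_integral g ?T)"
    using assms(2) recip_integral_nonneg[where g = g, OF assms(4,6) T] by (simp add: ennreal_mult[symmetric] divide_ennreal)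
  finally have le: "kernel_op G (\<lambda>_. 1) x / ennreal b \<le> ennreal (recip_integral g ?T)" .
  \<comment> \<open>The bound \<open>le\<close> is finite, so \<open>enn2real\<close> preserves the
    value of \<open>G1(x) / b\<close>.\<close>
  then have "recip_integral_inv g (enn2real (kernel_op G (\<lambda>_. 1) x / ennreal b)) \<le> ?T"
    using recip_integral_nonneg[where g = g, OF assms(4,6) T] T
    by (intro recip_integral_inv_le[where g = g, OF assms(4,6)]) (auto intro: enn2real_leI)
  then have "b * (recip_integral_inv g (enn2real (kernel_op G (\<lambda>_. 1) x / ennreal b)) - 1) \<le> b * (V / b)"
    using assms(2) by (intro mult_left_mono) auto
  then have "1 + b * (recip_integral_inv g (enn2real (kernel_op G (\<lambda>_. 1) x / ennreal b)) - 1)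
      \<le> enn2real (u x)"
    using assms(2) VU U by simp
  moreover have "kernel_op G (\<lambda>_. 1) x / ennreal b < recip_integral_total g"
    using le recip_integral_less_total[where g = g, OF assms(4,6) T] by (rule le_less_trans)
  ultimately show "1 + b * (recip_integral_inv g (enn2real (kernel_op G (\<lambda>_. 1) x / ennreal b)) - 1)
      \<le> enn2real (u x) \<and> kernel_op G (\<lambda>_. 1) x / ennreal b < recip_integral_total g"
    by blast
qed

end
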